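(* Let $R$ be a commutative Noetherian ring of finite Krull dimension and $M$ a finitely generated $R$-module. Every open submodule of $M$ is essential. In particular, in the canonical topology on $M$, the element $0$ is a limit point of every non-zero submodule $N\subseteq M$ (i.e. every open subset of $M$ containing $0$ contains a non-zero element of $N$).
   Context: Ordinal length: for a Noetherian module $M$, define recursively for submodules $N\subseteq M$ the height rank $\mathfrak l(M)=0$ and $\mathfrak l(N)=\sup\{\mathfrak l(N')+1 : N\subsetneq N'\subseteq M\}$ (an ordinal). Then $\operatorname{len}(M):=\mathfrak l(0)$; equivalently, it is the supremum of the order types of chains of non-zero submodules of $M$, well-ordered by reverse inclusion. A submodule $U\subseteq M$ is called open if $\operatorname{len}(U)=\operatorname{len}(M)$. The canonical topology on $M$ is the topology whose open sets are the unions of cosets $x+U$ with $x\in M$ and $U\subseteq M$ an open submodule (finite intersections of open submodules are open, and a submodule is open in this topology if and only if it is open in the sense of lengths). A submodule is essential if it meets every non-zero submodule of $M$ non-trivially. *)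

theory Defs
  imports "HOL-Library.Extended_Nat" "HOL-Analysis.Abstract_Topology" "HOL-Algebra.Ring_Divisibility" "HOL-Algebra.Module"
begin

subsection \<open>Ordinals\<close>

text \<open>Isomorphism classes of well-orders whose field is a set of elements of \<^typ>\<open>'a\<close>. These are
  exactly the ordinals of cardinality at most that of \<^typ>\<open>'a\<close>. The rank of an element for a
  transitive well-founded relation on \<^typ>\<open>'a\<close> is such an ordinal, by \<open>wf_rank_image\<close> below.\<close>

quotient_type 'a ordinal = "'a rel" / partial: "\<lambda>r s. (r, s) \<in> ordIso"
proof (rule part_equivpI)
  show "\<exists>r :: 'a rel. (r, r) \<in> ordIso"
    using ordIso_reflexive[of "{}"] by (auto simp: order_on_defs refl_on_def trans_def antisym_def total_on_def)
  show "symp (\<lambda>r s :: 'a rel. (r, s) \<in> ordIso)"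
    by (auto intro: sympI ordIso_symmetric)
  show "transp (\<lambda>r s :: 'a rel. (r, s) \<in> ordIso)"
    by (auto intro: transpI ordIso_transitive)
qed

lemma ordinal_cases:
  obtains s where "\<alpha> = abs_ordinal s" "(s, s) \<in> ordIso"
  using Quotient_abs_rep[OF Quotient_ordinal, of \<alpha>] Quotient_rep_reflp[OF Quotient_ordinal, of \<alpha>]
  by (metis (no_types))

instantiation ordinal :: (type) wellorder
begin

lift_definition less_eq_ordinal :: "'a ordinal \<Rightarrow> 'a ordinal \<Rightarrow> bool" is "\<lambda>r s. (r, s) \<in> ordLeq"
  by (meson ordIso_imp_ordLeq ordIso_symmetric ordLeq_transitive)

lift_definition less_ordinal :: "'a ordinal \<Rightarrow> 'a ordinal \<Rightarrow> bool" is "\<lambda>r s. (r, s) \<in> ordLess"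
  by (meson ordIso_ordLess_trans ordIso_symmetric ordLess_ordIso_trans)

instance
proof
  fix x y z :: "'a ordinal"
  show "x \<le> x"
    by transfer (simp add: ordIso_imp_ordLeq)
  show "x \<le> y \<Longrightarrow> y \<le> z \<Longrightarrow> x \<le> z"
    by transfer (rule ordLeq_transitive)
  show "x \<le> y \<Longrightarrow> y \<le> x \<Longrightarrow> x = y"
    by transfer (simp add: ordIso_iff_ordLeq)
  show "x < y \<longleftrightarrow> x \<le> y \<and> \<not> y \<le> x"
    by transfer (meson not_ordLess_ordLeq ordLess_imp_ordLeq ordLess_or_ordLeq ordLeq_Well_order_simp)
  show "x \<le> y \<or> y \<le> x"
    by transfer (meson ordIso_imp_ordLeq ordLeq_Well_order_simp ordLeq_total)
next
  fix P :: "'a ordinal \<Rightarrow> bool" and a :: "'a ordinal"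
  assume step: "\<And>x. (\<And>y. y < x \<Longrightarrow> P y) \<Longrightarrow> P x"
  have "(r, r) \<in> ordIso \<longrightarrow> P (abs_ordinal r)" for r :: "'a rel"
  proof (induction r rule: wf_induct_rule[OF wf_ordLess])
    case (1 r)
    show ?case
    proof (intro impI)
      assume r: "(r, r) \<in> ordIso"
      show "P (abs_ordinal r)"
      proof (rule step)
        fix y assume y: "y < abs_ordinal r"
        obtain s where s: "y = abs_ordinal s" "(s, s) \<in> ordIso"
          by (rule ordinal_cases)
        have "(s, r) \<in> ordLess" using y s r by (simp add: less_ordinal.abs_eq)
        thus "P y" using 1 s by blast
      qed
    qed
  qed
  thus "P a"
    using ordinal_cases[of a] by metis
qed

end

definition ord_succ :: "'a::wellorder \<Rightarrow> 'a" where
  "ord_succ \<alpha> = (LEAST \<beta>. \<alpha> < \<beta>)"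

definition ord_sup :: "'a::wellorder set \<Rightarrow> 'a" where
  "ord_sup A = (LEAST \<beta>. \<forall>\<alpha>\<in>A. \<alpha> \<le> \<beta>)"

definition wf_rank :: "'a rel \<Rightarrow> 'a \<Rightarrow> 'a ordinal" where
  "wf_rank r = wfrec r (\<lambda>l x. ord_sup {ord_succ (l y) | y. (y, x) \<in> r})"

lemma wf_rank_unfold:
  assumes "wf r"
  shows "wf_rank r x = ord_sup {ord_succ (wf_rank r y) | y. (y, x) \<in> r}"
proof -
  have "{ord_succ (cut (wf_rank r) r x y) | y. (y, x) \<in> r} = {ord_succ (wf_rank r y) | y. (y, x) \<in> r}"
    by (metis cut_apply)
  thus ?thesis
    unfolding wf_rank_def by (subst wfrec[OF assms]) (simp add: wf_rank_def)
qed

lemma Well_order_ordinal_le: "Well_order {(\<alpha>, \<beta> :: 'a ordinal). \<alpha> \<le> \<beta>}" (is "Well_order ?W")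
proof -
  have "?W - Id = {(\<alpha>, \<beta>). \<alpha> < \<beta>}"
    by auto
  hence "wf (?W - Id)"
    using wf by metis
  thus ?thesis
    by (auto simp: order_on_defs refl_on_def trans_def antisym_def total_on_def Field_def)
qed

lemma ordinal_iso_initial_segment:
  fixes r :: "'a rel"
  assumes r: "Well_order r"
  shows "(r, Restr {(\<alpha>, \<beta>). \<alpha> \<le> \<beta>} {\<alpha>. \<alpha> < abs_ordinal r}) \<in> ordIso"
proof -
  let ?f = "\<lambda>a. abs_ordinal (Restr r (underS r a))"
  let ?V = "{(\<alpha>, \<beta> :: 'a ordinal). \<alpha> \<le> \<beta>}"
  let ?W = "Restr ?V {\<alpha>. \<alpha> < abs_ordinal r}"
  have wo: "wo_rel r"
    using r by (simp add: wo_rel_def)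
  have refl: "(r, r) \<in> ordIso" "(Restr r A, Restr r A) \<in> ordIso" for A
    using r by (auto intro: ordIso_reflexive Well_order_Restr)
  have W: "Well_order ?W"
    by (intro Well_order_Restr Well_order_ordinal_le)
  have FW: "Field ?W = {\<alpha>. \<alpha> < abs_ordinal r}"
    by (auto simp: Field_def)
  have lt: "?f a < abs_ordinal r" if "a \<in> Field r" for a
    using that r refl ordLess_iff_ordIso_Restr[OF r Well_order_Restr[OF r]]
    by (auto simp: less_ordinal.abs_eq)
  have mono: "?f a \<le> ?f b" if "(a, b) \<in> r" for a b
  proof -
    have "underS r a \<subseteq> underS r b"
      using that wo underS_incl_iff[of r a b] wo_rel.LIN[OF wo] by (auto simp: Field_def)
    hence "(Restr r (underS r a), Restr r (underS r b)) \<in> ordLeq"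
      using ofilter_subset_ordLeq[OF r] wo_rel.underS_ofilter[OF wo] by blast
    thus ?thesis
      using refl by (simp add: less_eq_ordinal.abs_eq)
  qed
  have strict: "?f a < ?f b" if "(a, b) \<in> r" "a \<noteq> b" for a b
  proof -
    have "underS r a \<subseteq> underS r b"
      using that wo underS_incl_iff[of r a b] wo_rel.LIN[OF wo] by (auto simp: Field_def)
    moreover have "a \<in> underS r b" "a \<notin> underS r a"
      using that by (auto simp: underS_def)
    ultimately have "(Restr r (underS r a), Restr r (underS r b)) \<in> ordLess"
      using ofilter_subset_ordLess[OF r] wo_rel.underS_ofilter[OF wo] by blast
    thus ?thesis
      using refl by (simp add: less_ordinal.abs_eq)
  qed
  have inj: "inj_on ?f (Field r)"
  proof (rule inj_onI, rule ccontr)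
    fix a b assume *: "a \<in> Field r" "b \<in> Field r" "?f a = ?f b" "a \<noteq> b"
    hence "(a, b) \<in> r \<or> (b, a) \<in> r"
      using wo_rel.TOTAL[OF wo] by (auto simp: total_on_def)
    thus False
      using strict[of a b] strict[of b a] * by auto
  qed
  have surj: "\<alpha> \<in> ?f ` Field r" if \<alpha>: "\<alpha> < abs_ordinal r" for \<alpha>
  proof -
    obtain s where s: "\<alpha> = abs_ordinal s" "(s, s) \<in> ordIso"
      by (rule ordinal_cases)
    have "Well_order s"
      using s(2) by (simp add: ordIso_def)
    moreover have "(s, r) \<in> ordLess"
      using \<alpha> s refl by (simp add: less_ordinal.abs_eq)
    ultimately obtain a where a: "a \<in> Field r" "(s, Restr r (underS r a)) \<in> ordIso"
      using ordLess_iff_ordIso_Restr[OF r, of s] by blast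
    hence "\<alpha> = ?f a"
      using s(1) Quotient_rel_abs[OF Quotient_ordinal a(2)] by simp
    thus ?thesis
      using a by blast
  qed
  have "bij_betw ?f (Field r) (Field ?W)"
    unfolding bij_betw_def FW using inj lt surj by blast
  moreover have "compat r ?W ?f"
    unfolding compat_def using mono lt by (auto simp: FieldI1 FieldI2)
  ultimately show ?thesis
    using iso_iff3[OF r W] r W by (auto simp: ordIso_def)
qed

lemma not_range_eq_ordinals: "range (f :: 'a \<Rightarrow> 'a ordinal) \<noteq> UNIV"
proof
  assume surj: "range f = UNIV"
  let ?W = "{(\<alpha>, \<beta> :: 'a ordinal). \<alpha> \<le> \<beta>}"
  let ?r = "dir_image ?W (inv_into UNIV f)"
  have inj: "inj_on (inv_into UNIV f) A" for A
    using surj by (metis inj_on_subset subset_UNIV surj_imp_inj_inv)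
  have W: "Well_order ?W"
    by (rule Well_order_ordinal_le)
  have FW: "Field ?W = UNIV"
    by (auto simp: Field_def)
  have r: "Well_order ?r"
    by (rule Well_order_dir_image[OF W inj])
  have "underS ?W \<alpha> = {\<beta>. \<beta> < \<alpha>}" for \<alpha>
    by (auto simp: underS_def)
  hence "(Restr ?W {\<beta>. \<beta> < abs_ordinal ?r}, ?W) \<in> ordLess"
    using ordLess_iff_ordIso_Restr[OF W Well_order_Restr[OF W]] ordIso_reflexive[OF Well_order_Restr[OF W]]
    unfolding FW by (metis UNIV_I)
  moreover have "(?W, ?r) \<in> ordIso"
    by (rule dir_image_ordIso[OF W inj])
  ultimately show False
    using ordinal_iso_initial_segment[OF r]
    by (meson not_ordLess_ordIso ordIso_symmetric ordIso_transitive)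
qed

text \<open>The ranks below that of \<open>x\<close> are exactly the ranks of the elements below \<open>x\<close>. In particular,
  although \<^typ>\<open>'a ordinal\<close> is bounded, the least elements in \<open>ord_succ\<close> and \<open>ord_sup\<close> exist wherever
  \<open>wf_rank\<close> uses them.\<close>

lemma wf_rank_image:
  assumes "wf r" "trans r"
  shows "wf_rank r ` {y. (y, x) \<in> r} = {\<alpha>. \<alpha> < wf_rank r x}"
  using \<open>wf r\<close>
proof (induction x rule: wf_induct_rule)
  case (less x)
  let ?S = "wf_rank r ` {y. (y, x) \<in> r}"
  have down: "\<beta> \<in> ?S" if *: "\<alpha> \<in> ?S" "\<beta> \<le> \<alpha>" for \<alpha> \<beta>
  proof (cases "\<beta> = \<alpha>")
    case False
    obtain y where y: "(y, x) \<in> r" "\<alpha> = wf_rank r y"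
      using * by blast
    have "\<beta> \<in> wf_rank r ` {z. (z, y) \<in> r}"
      using less.IH[OF y(1)] y * False by simp
    thus ?thesis
      using y \<open>trans r\<close> by (auto dest: transD)
  qed (use * in blast)
  define \<sigma> where "\<sigma> = (LEAST \<sigma>. \<sigma> \<notin> ?S)"
  have "\<exists>\<sigma>. \<sigma> \<notin> ?S"
    using not_range_eq_ordinals[of "wf_rank r"] by blast
  hence "\<sigma> \<notin> ?S"
    unfolding \<sigma>_def by (rule LeastI_ex)
  hence S: "?S = {\<alpha>. \<alpha> < \<sigma>}"
  proof (intro equalityI subsetI)
    fix \<alpha> assume "\<alpha> \<in> ?S"
    hence "\<not> \<sigma> \<le> \<alpha>"
      using down \<open>\<sigma> \<notin> ?S\<close> by blast
    thus "\<alpha> \<in> {\<alpha>. \<alpha> < \<sigma>}"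
      by simp
  next
    fix \<alpha> assume "\<alpha> \<in> {\<alpha>. \<alpha> < \<sigma>}"
    thus "\<alpha> \<in> ?S"
      unfolding \<sigma>_def using not_less_Least by blast
  qed
  have succ: "\<alpha> < ord_succ \<alpha>" "ord_succ \<alpha> \<le> \<sigma>" if "\<alpha> < \<sigma>" for \<alpha>
    unfolding ord_succ_def using that by (auto intro: LeastI Least_le)
  have "wf_rank r x = ord_sup (ord_succ ` ?S)"
    by (subst wf_rank_unfold[OF \<open>wf r\<close>]) (rule arg_cong[of _ _ ord_sup], auto)
  also have "\<dots> = \<sigma>"
    unfolding ord_sup_def
  proof (rule Least_equality)
    show "\<forall>\<alpha>\<in>ord_succ ` ?S. \<alpha> \<le> \<sigma>"
      using succ S by auto
    fix \<beta> assume \<beta>: "\<forall>\<alpha>\<in>ord_succ ` ?S. \<alpha> \<le> \<beta>"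
    show "\<sigma> \<le> \<beta>"
    proof (rule ccontr)
      assume "\<not> \<sigma> \<le> \<beta>"
      hence "\<beta> \<in> ?S" "\<beta> < ord_succ \<beta>"
        using S succ by auto
      thus False
        using \<beta> by force
    qed
  qed
  finally show ?case
    using S by simp
qed


subsection \<open>Commutative algebra\<close>

text \<open>This gives \<open>0\<close> instead of \<open>-\<infinity>\<close> for the zero ring, which has no prime ideals.\<close>

definition krull_dim :: "('a, 'm) ring_scheme \<Rightarrow> enat" where
  "krull_dim R = (SUP C \<in> {C. finite C \<and> C \<noteq> {} \<and> subset.chain {P. primeideal P R} C}. enat (card C - 1))"

definition finitely_generated_module :: "('a, 'm) ring_scheme \<Rightarrow> ('a, 'b, 'n) module_scheme \<Rightarrow> bool" where
  "finitely_generated_module R M \<longleftrightarrow>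
     (\<exists>A. finite A \<and> A \<subseteq> carrier M \<and> \<Inter>{H. submodule H R M \<and> A \<subseteq> H} = carrier M)"

definition essential_submodule :: "('a, 'm) ring_scheme \<Rightarrow> ('a, 'b, 'n) module_scheme \<Rightarrow> 'b set \<Rightarrow> bool" where
  "essential_submodule R M U \<longleftrightarrow>
     submodule U R M \<and> (\<forall>N. submodule N R M \<and> N \<noteq> {\<zero>\<^bsub>M\<^esub>} \<longrightarrow> U \<inter> N \<noteq> {\<zero>\<^bsub>M\<^esub>})"


subsection \<open>Ordinal length\<close>

text \<open>The larger submodule comes first, so this relation is well-founded iff \<open>M\<close> is Noetherian, and
  the recursion for the height rank starts at \<open>M\<close>.\<close>

definition submodule_above :: "('a, 'm) ring_scheme \<Rightarrow> ('a, 'b, 'n) module_scheme \<Rightarrow> 'b set rel" where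
  "submodule_above R M = {(N', N). submodule N' R M \<and> submodule N R M \<and> N \<subset> N'}"

definition height_rank :: "('a, 'm) ring_scheme \<Rightarrow> ('a, 'b, 'n) module_scheme \<Rightarrow> 'b set \<Rightarrow> 'b set ordinal" where
  "height_rank R M = wf_rank (submodule_above R M)"

lemma height_rank_rec:
  assumes "wf (submodule_above R M)" "submodule N R M"
  shows "height_rank R M N = ord_sup {ord_succ (height_rank R M N') | N'. submodule N' R M \<and> N \<subset> N'}"
  unfolding height_rank_def
  by (subst wf_rank_unfold[OF assms(1)]) (simp add: submodule_above_def assms(2))

definition ordinal_length :: "('a, 'm) ring_scheme \<Rightarrow> ('a, 'b, 'n) module_scheme \<Rightarrow> 'b set ordinal" where
  "ordinal_length R M = height_rank R M {\<zero>\<^bsub>M\<^esub>}"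

definition open_submodule :: "('a, 'm) ring_scheme \<Rightarrow> ('a, 'b, 'n) module_scheme \<Rightarrow> 'b set \<Rightarrow> bool" where
  "open_submodule R M U \<longleftrightarrow>
     submodule U R M \<and> ordinal_length R (M\<lparr>carrier := U\<rparr>) = ordinal_length R M"

definition canonical_topology :: "('a, 'm) ring_scheme \<Rightarrow> ('a, 'b, 'n) module_scheme \<Rightarrow> 'b topology" where
  "canonical_topology R M =
     topology (\<lambda>S. \<exists>\<C> \<subseteq> {x <+\<^bsub>M\<^esub> U | x U. x \<in> carrier M \<and> open_submodule R M U}. S = \<Union>\<C>)"


subsection \<open>The unions of cosets form a topology\<close>

text \<open>The constructor \<open>topology\<close> is meaningful only on families closed under unions and finite
  intersections. For a Noetherian module this holds in \<open>canonical_topology\<close>, by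
  \<open>openin_canonical_topology\<close> at the end.\<close>

lemma submodule_restrict_iff:
  assumes "module R M" "submodule U R M"
  shows "submodule N R (M\<lparr>carrier := U\<rparr>) \<longleftrightarrow> submodule N R M \<and> N \<subseteq> U"
proof -
  have U: "module R (M\<lparr>carrier := U\<rparr>)" "U \<subseteq> carrier M"
    using assms submodule.submodule_is_module module.submoduleE(1) by blast+
  show ?thesis
  proof safe
    assume N: "submodule N R (M\<lparr>carrier := U\<rparr>)"
    show "\<And>x. x \<in> N \<Longrightarrow> x \<in> U"
      using module.submoduleE(1)[OF U(1) N] by auto
    hence "N \<subseteq> carrier M" using U by auto
    thus "submodule N R M"
      using module.module_incl_imp_submodule[OF assms(1)] submodule.submodule_is_module[OF N U(1)] by simp
  next
    assume N: "submodule N R M" "N \<subseteq> U"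
    show "submodule N R (M\<lparr>carrier := U\<rparr>)"
      by (rule module.module_incl_imp_submodule[OF U(1)])
        (simp_all add: N(2) submodule.submodule_is_module[OF N(1) assms(1)])
  qed
qed

lemma trans_submodule_above: "trans (submodule_above R M)"
  unfolding trans_def submodule_above_def by auto

lemma wf_submodule_above_restrict:
  assumes "wf (submodule_above R M)" "module R M" "submodule U R M"
  shows "wf (submodule_above R (M\<lparr>carrier := U\<rparr>))"
  using assms(1)
  by (rule wf_subset) (auto simp: submodule_above_def submodule_restrict_iff[OF assms(2,3)])

lemma less_height_rank_iff:
  assumes "wf (submodule_above R M)" "submodule N R M"
  shows "\<alpha> < height_rank R M N \<longleftrightarrow> (\<exists>N'. submodule N' R M \<and> N \<subset> N' \<and> height_rank R M N' = \<alpha>)"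
proof -
  have "\<alpha> < height_rank R M N \<longleftrightarrow> \<alpha> \<in> height_rank R M ` {N'. (N', N) \<in> submodule_above R M}"
    unfolding height_rank_def wf_rank_image[OF assms(1) trans_submodule_above, of N] by simp
  thus ?thesis
    using assms(2) by (auto simp: submodule_above_def)
qed

lemma height_rank_mono:
  assumes wf: "wf (submodule_above R M)" and "submodule N R M" "submodule N' R M" "N \<subseteq> N'"
  shows "height_rank R M N' \<le> height_rank R M N"
  using less_height_rank_iff[OF wf assms(2), of "height_rank R M N'"] assms by (cases "N = N'") auto

lemma height_rank_restrict_le:
  assumes M: "module R M" and wf: "wf (submodule_above R M)" and U: "submodule U R M" and
    N: "submodule N R M" "N \<subseteq> U"
  shows "height_rank R (M\<lparr>carrier := U\<rparr>) N \<le> height_rank R M N"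
  using wf N
proof (induction N rule: wf_induct_rule)
  case (less N)
  note UN = submodule_restrict_iff[OF M U]
  show ?case
  proof (rule ccontr)
    assume "\<not> ?thesis"
    then obtain N' where N': "submodule N' R M" "N' \<subseteq> U" "N \<subset> N'"
      "height_rank R (M\<lparr>carrier := U\<rparr>) N' = height_rank R M N"
      using less_height_rank_iff[OF wf_submodule_above_restrict[OF wf M U], of N] less.prems UN
      by (auto simp: not_le)
    hence "height_rank R M N \<le> height_rank R M N'"
      using less.IH[of N'] less.prems by (auto simp: submodule_above_def)
    moreover have "height_rank R M N' < height_rank R M N"
      using less_height_rank_iff[OF wf] less.prems N' by blast
    ultimately show False by simp
  qed
qed

context module begin

lemma submodule_zero: "submodule N R M \<Longrightarrow> \<zero>\<^bsub>M\<^esub> \<in> N"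
  using submodule.axioms(1) subgroup.one_closed by fastforce

lemma submodule_zero_set: "submodule {\<zero>\<^bsub>M\<^esub>} R M"
  by (rule submoduleI) auto

lemma submodule_Int:
  assumes "submodule P R M" "submodule Q R M"
  shows "submodule (P \<inter> Q) R M"
  using assms submoduleE[OF assms(1)] submoduleE[OF assms(2)]
  by (intro submoduleI) (auto simp: submodule_zero)

lemma submodule_add:
  assumes P: "submodule P R M" and Q: "submodule Q R M"
  shows "submodule (P <+>\<^bsub>M\<^esub> Q) R M"
proof (rule submoduleI)
  note p = submoduleE[OF P] submodule_zero[OF P] and q = submoduleE[OF Q] submodule_zero[OF Q]
  show "P <+>\<^bsub>M\<^esub> Q \<subseteq> carrier M"
    using p(1) q(1) by (auto simp: set_add_def')
  show "\<zero>\<^bsub>M\<^esub> \<in> P <+>\<^bsub>M\<^esub> Q"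
    using p q by (force simp: set_add_def')
  fix a assume a: "a \<in> P <+>\<^bsub>M\<^esub> Q"
  then obtain x y where xy: "x \<in> P" "y \<in> Q" "a = x \<oplus>\<^bsub>M\<^esub> y"
    by (auto simp: set_add_def')
  have "x \<in> carrier M" "y \<in> carrier M" using xy p(1) q(1) by auto
  hence "\<ominus>\<^bsub>M\<^esub> a = (\<ominus>\<^bsub>M\<^esub> x) \<oplus>\<^bsub>M\<^esub> (\<ominus>\<^bsub>M\<^esub> y)"
    using xy by (simp add: M.minus_add)
  thus "\<ominus>\<^bsub>M\<^esub> a \<in> P <+>\<^bsub>M\<^esub> Q"
    using p(3) q(3) xy by (auto simp: set_add_def')
  { fix r assume "r \<in> carrier R"
    hence "r \<odot>\<^bsub>M\<^esub> a = (r \<odot>\<^bsub>M\<^esub> x) \<oplus>\<^bsub>M\<^esub> (r \<odot>\<^bsub>M\<^esub> y)"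
      using xy p(1) q(1) by (simp add: smult_r_distr subset_iff)
    thus "r \<odot>\<^bsub>M\<^esub> a \<in> P <+>\<^bsub>M\<^esub> Q"
      using p(4)[of r x] q(4)[of r y] xy(1,2) \<open>r \<in> carrier R\<close> unfolding set_add_def' by blast }
  fix b assume "b \<in> P <+>\<^bsub>M\<^esub> Q"
  then obtain x' y' where xy': "x' \<in> P" "y' \<in> Q" "b = x' \<oplus>\<^bsub>M\<^esub> y'"
    by (auto simp: set_add_def')
  have "x' \<in> carrier M" "y' \<in> carrier M" using xy' p(1) q(1) by auto
  hence "a \<oplus>\<^bsub>M\<^esub> b = (x \<oplus>\<^bsub>M\<^esub> x') \<oplus>\<^bsub>M\<^esub> (y \<oplus>\<^bsub>M\<^esub> y')"
    using xy xy' \<open>x \<in> carrier M\<close> \<open>y \<in> carrier M\<close> by (simp add: M.a_ac)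
  thus "a \<oplus>\<^bsub>M\<^esub> b \<in> P <+>\<^bsub>M\<^esub> Q"
    using p(5)[of x x'] q(5)[of y y'] xy(1,2) xy'(1,2) unfolding set_add_def' by blast
qed

lemma set_add_commute:
  assumes "P \<subseteq> carrier M" "Q \<subseteq> carrier M"
  shows "P <+>\<^bsub>M\<^esub> Q = Q <+>\<^bsub>M\<^esub> P"
proof -
  have "p \<oplus>\<^bsub>M\<^esub> q = q \<oplus>\<^bsub>M\<^esub> p" if "p \<in> P" "q \<in> Q" for p q
    using that assms M.a_comm by blast
  thus ?thesis
    unfolding set_add_def' by fastforce
qed

lemma submodule_modular:
  assumes P: "submodule P R M" "submodule P' R M" "P \<subseteq> P'" and Q: "submodule Q R M" "submodule Q' R M" "Q \<subseteq> Q'"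
    and eq: "P' <+>\<^bsub>M\<^esub> Q' \<subseteq> P <+>\<^bsub>M\<^esub> Q" "P' \<inter> Q' \<subseteq> P \<inter> Q"
  shows "P = P'"
proof -
  have "P' \<subseteq> P"
  proof
    fix x assume x: "x \<in> P'"
    have c: "P' \<subseteq> carrier M" "Q' \<subseteq> carrier M"
      using submoduleE(1) P Q by blast+
    have "x = x \<oplus>\<^bsub>M\<^esub> \<zero>\<^bsub>M\<^esub>" using x c by auto
    hence "x \<in> P' <+>\<^bsub>M\<^esub> Q'"
      using x submodule_zero[OF Q(2)] unfolding set_add_def' by blast
    then obtain p q where pq: "p \<in> P" "q \<in> Q" "x = p \<oplus>\<^bsub>M\<^esub> q"
      using eq(1) unfolding set_add_def' by blast
    have cc: "p \<in> carrier M" "q \<in> carrier M"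
      using pq c P Q by auto
    have "q = \<ominus>\<^bsub>M\<^esub> p \<oplus>\<^bsub>M\<^esub> x"
      using pq cc by (simp add: M.r_neg1 M.a_assoc[symmetric] M.l_neg)
    moreover have "\<ominus>\<^bsub>M\<^esub> p \<in> P'"
      using pq P submoduleE(3)[OF P(2)] by auto
    ultimately have "q \<in> P'"
      using x submoduleE(5)[OF P(2)] by auto
    hence "q \<in> P" using eq(2) pq Q by auto
    thus "x \<in> P" using pq submoduleE(5)[OF P(1)] by auto
  qed
  thus ?thesis using P by auto
qed

end

text \<open>The rank of \<open>(\<alpha>, \<beta>)\<close> for this relation plays the role of the natural sum of \<open>\<alpha>\<close> and \<open>\<beta>\<close>.\<close>

definition prod_less :: "('a::wellorder \<times> 'a) rel" where
  "prod_less = {((a', b'), (a, b)). a' \<le> a \<and> b' \<le> b \<and> (a' \<noteq> a \<or> b' \<noteq> b)}"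

lemma wf_prod_less: "wf (prod_less :: ('a::wellorder \<times> 'a) rel)"
proof (rule wf_subset[OF wf_lex_prod])
  show "wf {(x, y :: 'a). x < y}" "wf {(x, y :: 'a). x < y}" by (fact wf)+
  show "prod_less \<subseteq> {(x, y :: 'a). x < y} <*lex*> {(x, y). x < y}"
    by (auto simp: prod_less_def)
qed

lemma trans_prod_less: "trans (prod_less :: ('a::wellorder \<times> 'a) rel)"
  unfolding trans_def prod_less_def by auto

lemma wf_rank_prod_less:
  "\<alpha> < wf_rank prod_less p \<longleftrightarrow> (\<exists>q. (q, p) \<in> prod_less \<and> wf_rank prod_less q = \<alpha>)"
proof -
  have "\<alpha> < wf_rank prod_less p \<longleftrightarrow> \<alpha> \<in> wf_rank prod_less ` {q. (q, p) \<in> prod_less}"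
    unfolding wf_rank_image[OF wf_prod_less trans_prod_less, of p] by simp
  thus ?thesis
    by blast
qed

lemma wf_rank_prod_less_mono:
  "(q, p) \<in> prod_less \<Longrightarrow> wf_rank prod_less q < wf_rank prod_less p"
  using wf_rank_prod_less by blast

lemma set_add_mono': "P \<subseteq> P' \<Longrightarrow> Q \<subseteq> Q' \<Longrightarrow> P <+>\<^bsub>M\<^esub> Q \<subseteq> P' <+>\<^bsub>M\<^esub> Q'"
  by (auto simp: set_add_def')

lemma height_rank_sum_le:
  assumes M: "module R M" and wf: "wf (submodule_above R M)"
    and U: "submodule U R M" and V: "submodule V R M"
    and P: "submodule P R M" "P \<subseteq> U" and Q: "submodule Q R M" "Q \<subseteq> V"
  shows "wf_rank prod_less (height_rank R (M\<lparr>carrier := U\<rparr>) P, height_rank R (M\<lparr>carrier := V\<rparr>) Q)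
    \<le> wf_rank prod_less (height_rank R M (P <+>\<^bsub>M\<^esub> Q), height_rank R (M\<lparr>carrier := U \<inter> V\<rparr>) (P \<inter> Q))"
    (is "?L P Q \<le> ?R P Q")
proof -
  interpret module R M by (rule M)
  let ?I = "U \<inter> V"
  have I: "submodule ?I R M" by (rule submodule_Int[OF U V])
  note restr = submodule_restrict_iff[OF M U] submodule_restrict_iff[OF M V] submodule_restrict_iff[OF M I]
  note wfs = wf_submodule_above_restrict[OF wf M U] wf_submodule_above_restrict[OF wf M V] wf_submodule_above_restrict[OF wf M I]
  let ?hU = "height_rank R (M\<lparr>carrier := U\<rparr>)" and ?hV = "height_rank R (M\<lparr>carrier := V\<rparr>)"
    and ?hI = "height_rank R (M\<lparr>carrier := ?I\<rparr>)" and ?hM = "height_rank R M"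
  have "wf (inv_image prod_less (\<lambda>(P, Q). (?hU P, ?hV Q)))"
    by (intro wf_inv_image wf_prod_less)
  hence "submodule P R M \<longrightarrow> P \<subseteq> U \<longrightarrow> submodule Q R M \<longrightarrow> Q \<subseteq> V \<longrightarrow> ?L P Q \<le> ?R P Q" 
  proof (induction "(P, Q)" arbitrary: P Q rule: wf_induct_rule)
    case (less P Q)
    show ?case
    proof (intro impI, rule ccontr)
      assume P: "submodule P R M" "P \<subseteq> U" and Q: "submodule Q R M" "Q \<subseteq> V" and "\<not> ?L P Q \<le> ?R P Q"
      then obtain a b where ab: "((a, b), (?hU P, ?hV Q)) \<in> prod_less" "wf_rank prod_less (a, b) = ?R P Q"
        using wf_rank_prod_less by (metis not_le surj_pair)
      have "a \<le> ?hU P" "b \<le> ?hV Q"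
        using ab by (auto simp: prod_less_def)
      have "\<exists>P'. submodule P' R M \<and> P' \<subseteq> U \<and> P \<subseteq> P' \<and> ?hU P' = a"
        using \<open>a \<le> ?hU P\<close> less_height_rank_iff[OF wfs(1), of P a] P restr by (cases "a = ?hU P") auto
      then obtain P' where P': "submodule P' R M" "P' \<subseteq> U" "P \<subseteq> P'" "?hU P' = a" by blast
      have "\<exists>Q'. submodule Q' R M \<and> Q' \<subseteq> V \<and> Q \<subseteq> Q' \<and> ?hV Q' = b"
        using \<open>b \<le> ?hV Q\<close> less_height_rank_iff[OF wfs(2), of Q b] Q restr by (cases "b = ?hV Q") auto
      then obtain Q' where Q': "submodule Q' R M" "Q' \<subseteq> V" "Q \<subseteq> Q'" "?hV Q' = b" by blast
      have "((P', Q'), (P, Q)) \<in> inv_image prod_less (\<lambda>(P, Q). (?hU P, ?hV Q))"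
        using ab P' Q' by auto
      from less(1)[OF this] have IH: "?L P' Q' \<le> ?R P' Q'"
        using P' Q' by blast
      have ne: "P \<noteq> P' \<or> Q \<noteq> Q'"
        using ab P' Q' by (auto simp: prod_less_def)
      have ne2: "P <+>\<^bsub>M\<^esub> Q \<noteq> P' <+>\<^bsub>M\<^esub> Q' \<or> P \<inter> Q \<noteq> P' \<inter> Q'"
      proof (rule ccontr)
        assume *: "\<not> ?thesis"
        hence "P = P'"
          using submodule_modular[of P P' Q Q'] P P' Q Q' by blast
        moreover have "Q <+>\<^bsub>M\<^esub> P = P <+>\<^bsub>M\<^esub> Q" "Q' <+>\<^bsub>M\<^esub> P' = P' <+>\<^bsub>M\<^esub> Q'"
          using set_add_commute submoduleE(1) P P' Q Q' by metis+
        hence "Q = Q'"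
          using submodule_modular[of Q Q' P P'] P P' Q Q' * by blast
        ultimately show False using ne by simp
      qed
      have sub: "P <+>\<^bsub>M\<^esub> Q \<subseteq> P' <+>\<^bsub>M\<^esub> Q'" "P \<inter> Q \<subseteq> P' \<inter> Q'"
        using P' Q' set_add_mono'[of P P' Q Q'] by blast+
      have s: "submodule (P <+>\<^bsub>M\<^esub> Q) R M" "submodule (P' <+>\<^bsub>M\<^esub> Q') R M"
          "submodule (P \<inter> Q) R (M\<lparr>carrier := ?I\<rparr>)" "submodule (P' \<inter> Q') R (M\<lparr>carrier := ?I\<rparr>)"
        using P Q P' Q' restr submodule_add submodule_Int by auto
      have le1: "?hM (P' <+>\<^bsub>M\<^esub> Q') \<le> ?hM (P <+>\<^bsub>M\<^esub> Q)"
        by (rule height_rank_mono[OF wf s(1,2) sub(1)])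
      have le2: "?hI (P' \<inter> Q') \<le> ?hI (P \<inter> Q)"
        by (rule height_rank_mono[OF wfs(3) s(3,4) sub(2)])
      have lt1: "?hM (P' <+>\<^bsub>M\<^esub> Q') < ?hM (P <+>\<^bsub>M\<^esub> Q)" if "P <+>\<^bsub>M\<^esub> Q \<subset> P' <+>\<^bsub>M\<^esub> Q'"
        using less_height_rank_iff[OF wf s(1)] s(2) that by blast
      have lt2: "?hI (P' \<inter> Q') < ?hI (P \<inter> Q)" if "P \<inter> Q \<subset> P' \<inter> Q'"
        using less_height_rank_iff[OF wfs(3) s(3)] s(4) that by blast
      have "P <+>\<^bsub>M\<^esub> Q \<subset> P' <+>\<^bsub>M\<^esub> Q' \<or> P \<inter> Q \<subset> P' \<inter> Q'"
        using ne2 sub unfolding psubset_eq by simp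
      hence "?hM (P' <+>\<^bsub>M\<^esub> Q') \<noteq> ?hM (P <+>\<^bsub>M\<^esub> Q) \<or> ?hI (P' \<inter> Q') \<noteq> ?hI (P \<inter> Q)"
        using less_imp_neq[OF lt1] less_imp_neq[OF lt2] by argo
      hence "((?hM (P' <+>\<^bsub>M\<^esub> Q'), ?hI (P' \<inter> Q')), (?hM (P <+>\<^bsub>M\<^esub> Q), ?hI (P \<inter> Q))) \<in> prod_less"
        using le1 le2 unfolding prod_less_def by simp
      hence "?R P' Q' < ?R P Q"
        by (rule wf_rank_prod_less_mono)
      thus False
        using IH ab P' Q' by simp
    qed
  qed
  thus ?thesis using P Q by blast
qed

lemma open_submodule_Int:
  assumes M: "module R M" and wf: "wf (submodule_above R M)"
    and U: "open_submodule R M U" and V: "open_submodule R M V"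
  shows "open_submodule R M (U \<inter> V)"
proof -
  interpret module R M by (rule M)
  have UV: "submodule U R M" "submodule V R M" "submodule (U \<inter> V) R M"
    using U V submodule_Int by (auto simp: open_submodule_def)
  have z: "\<zero>\<^bsub>M\<^esub> \<in> U" "\<zero>\<^bsub>M\<^esub> \<in> V"
    using UV submodule_zero by auto
  let ?a = "ordinal_length R M" and ?c = "ordinal_length R (M\<lparr>carrier := U \<inter> V\<rparr>)"
  have 0: "{\<zero>\<^bsub>M\<^esub>} <+>\<^bsub>M\<^esub> {\<zero>\<^bsub>M\<^esub>} = {\<zero>\<^bsub>M\<^esub>}"
    by (auto simp: set_add_def')
  have "wf_rank prod_less (?a, ?a) \<le> wf_rank prod_less (?a, ?c)"
    using height_rank_sum_le[OF M wf UV(1,2) submodule_zero_set _ submodule_zero_set] z U V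
    by (simp add: 0 ordinal_length_def open_submodule_def)
  hence "\<not> ((?a, ?c), (?a, ?a)) \<in> prod_less"
    using wf_rank_prod_less_mono leD by blast
  moreover have "?c \<le> ?a"
    using height_rank_restrict_le[OF M wf UV(3) submodule_zero_set] z by (simp add: ordinal_length_def)
  ultimately have "?c = ?a"
    by (auto simp: prod_less_def)
  thus ?thesis
    using UV by (simp add: open_submodule_def)
qed

lemma istopology_unions:
  assumes base: "\<And>A B z. A \<in> \<B> \<Longrightarrow> z \<in> A \<Longrightarrow> B \<in> \<B> \<Longrightarrow> z \<in> B \<Longrightarrow> \<exists>D\<in>\<B>. z \<in> D \<and> D \<subseteq> A \<inter> B"
  shows "istopology (\<lambda>S. \<exists>\<C>\<subseteq>\<B>. S = \<Union>\<C>)"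
proof -
  have iff: "(\<exists>\<C>\<subseteq>\<B>. S = \<Union>\<C>) \<longleftrightarrow> (\<forall>z\<in>S. \<exists>B\<in>\<B>. z \<in> B \<and> B \<subseteq> S)" for S
  proof
    assume "\<forall>z\<in>S. \<exists>B\<in>\<B>. z \<in> B \<and> B \<subseteq> S"
    hence "S = \<Union>{B \<in> \<B>. B \<subseteq> S}" by blast
    thus "\<exists>\<C>\<subseteq>\<B>. S = \<Union>\<C>" by (intro exI[of _ "{B \<in> \<B>. B \<subseteq> S}"]) auto
  qed blast
  show ?thesis
    unfolding istopology_def iff
  proof (intro conjI allI impI ballI)
    fix S T z
    assume "\<forall>z\<in>S. \<exists>B\<in>\<B>. z \<in> B \<and> B \<subseteq> S" "\<forall>z\<in>T. \<exists>B\<in>\<B>. z \<in> B \<and> B \<subseteq> T" "z \<in> S \<inter> T"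
    then obtain A B where AB: "A \<in> \<B>" "z \<in> A" "A \<subseteq> S" "B \<in> \<B>" "z \<in> B" "B \<subseteq> T"
      by blast
    from base[OF AB(1,2,4,5)] AB(3,6) show "\<exists>B\<in>\<B>. z \<in> B \<and> B \<subseteq> S \<inter> T"
      by blast
  next
    fix K z assume "\<forall>S\<in>K. \<forall>z\<in>S. \<exists>B\<in>\<B>. z \<in> B \<and> B \<subseteq> S" "z \<in> \<Union>K"
    thus "\<exists>B\<in>\<B>. z \<in> B \<and> B \<subseteq> \<Union>K" by (meson UnionE Union_upper subset_trans)
  qed
qed

lemma openin_canonical_topology:
  assumes M: "module R M" and wf: "wf (submodule_above R M)"
  shows "openin (canonical_topology R M) S \<longleftrightarrow>
    (\<exists>\<C> \<subseteq> {x <+\<^bsub>M\<^esub> U | x U. x \<in> carrier M \<and> open_submodule R M U}. S = \<Union>\<C>)"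
proof -
  interpret module R M by (rule M)
  let ?B = "{x <+\<^bsub>M\<^esub> U | x U. x \<in> carrier M \<and> open_submodule R M U}"
  have sub: "submodule U R M" "U \<subseteq> carrier M" if "open_submodule R M U" for U
    using that submoduleE(1) by (auto simp: open_submodule_def)
  have mem: "z \<in> z <+\<^bsub>M\<^esub> U" if "z \<in> carrier M" "open_submodule R M U" for z U
    using that submodule_zero[OF sub(1)[OF that(2)]] by (force simp: a_l_coset_def')
  have absorb: "z <+\<^bsub>M\<^esub> W \<subseteq> x <+\<^bsub>M\<^esub> U"
    if *: "z \<in> x <+\<^bsub>M\<^esub> U" "open_submodule R M U" "W \<subseteq> U" "x \<in> carrier M" for x z U W
  proof
    fix w assume "w \<in> z <+\<^bsub>M\<^esub> W"
    then obtain u v where "u \<in> U" "v \<in> U" "w = (x \<oplus>\<^bsub>M\<^esub> u) \<oplus>\<^bsub>M\<^esub> v"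
      using * by (auto simp: a_l_coset_def')
    moreover from this have "w = x \<oplus>\<^bsub>M\<^esub> (u \<oplus>\<^bsub>M\<^esub> v)"
      using * sub(2) by (auto simp: M.a_assoc subset_iff)
    ultimately show "w \<in> x <+\<^bsub>M\<^esub> U"
      using submoduleE(5)[OF sub(1)[OF *(2)], of u v] unfolding a_l_coset_def' by blast
  qed
  have "istopology (\<lambda>S. \<exists>\<C>\<subseteq>?B. S = \<Union>\<C>)"
  proof (rule istopology_unions)
    fix A B z assume A: "A \<in> ?B" "z \<in> A" and B: "B \<in> ?B" "z \<in> B"
    obtain x U where U: "x \<in> carrier M" "open_submodule R M U" "A = x <+\<^bsub>M\<^esub> U"
      using A by auto
    obtain y V where V: "y \<in> carrier M" "open_submodule R M V" "B = y <+\<^bsub>M\<^esub> V"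
      using B by auto
    have UV: "open_submodule R M (U \<inter> V)"
      by (rule open_submodule_Int[OF M wf U(2) V(2)])
    have z: "z \<in> carrier M"
      using U A(2) sub(2)[OF U(2)] by (auto simp: a_l_coset_def')
    show "\<exists>D\<in>?B. z \<in> D \<and> D \<subseteq> A \<inter> B"
    proof (intro bexI[of _ "z <+\<^bsub>M\<^esub> (U \<inter> V)"] conjI)
      show "z <+\<^bsub>M\<^esub> (U \<inter> V) \<subseteq> A \<inter> B"
        using absorb[of z x U "U \<inter> V"] absorb[of z y V "U \<inter> V"] U V A(2) B(2) by simp
      show "z <+\<^bsub>M\<^esub> (U \<inter> V) \<in> ?B"
        using z UV by blast
      show "z \<in> z <+\<^bsub>M\<^esub> (U \<inter> V)"
        using z UV by (rule mem)
    qed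
  qed
  thus ?thesis
    unfolding canonical_topology_def by (simp add: topology_inverse')
qed

end

theory Submission
  imports Defs
begin

text \<open>If \<open>U \<inter> N = 0\<close>, then \<open>U \<oplus> N \<subseteq> M\<close> bounds the natural sum of \<open>len U\<close> and \<open>len N\<close> by \<open>len M\<close>.
  Since the natural sum is strictly increasing, \<open>len U = len M\<close> forces \<open>len N = 0\<close>, that is
  \<open>N = 0\<close>.\<close>

section \<open>Ascending chain condition for finitely generated modules\<close>

text \<open>The terms of a strictly ascending sequence of ideals form a chain. In a Noetherian ring
  the union of a non-empty chain of ideals is one of its members, so the union is some
  \<open>f n\<close>, which cannot contain \<open>f (Suc n)\<close>.\<close>

lemma (in noetherian_ring) wf_ideal_above: "wf {(I', I). ideal I' R \<and> ideal I R \<and> I \<subset> I'}"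
  unfolding wf_iff_no_infinite_down_chain
proof (rule notI, elim exE)
  fix f :: "nat \<Rightarrow> 'a set"
  assume "\<forall>i. (f (Suc i), f i) \<in> {(I', I). ideal I' R \<and> ideal I R \<and> I \<subset> I'}"
  hence f: "ideal (f i) R" "f i \<subset> f (Suc i)" for i
    by auto
  have mono: "f i \<subseteq> f j" if "i \<le> j" for i j
    by (rule lift_Suc_mono_le[OF _ that]) (use f(2) in blast)
  have "subset.chain {I. ideal I R} (range f)"
  proof (unfold subset.chain_def, intro conjI ballI)
    fix I J assume "I \<in> range f" "J \<in> range f"
    then obtain i j where "I = f i" "J = f j"
      by blast
    thus "(\<subset>)\<^sup>=\<^sup>= I J \<or> (\<subset>)\<^sup>=\<^sup>= J I"
      using mono[of i j] mono[of j i] nat_le_linear[of i j] by blast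
  qed (use f(1) in blast)
  hence "\<Union>(range f) \<in> range f"
    by (intro ideal_chain_is_trivial) auto
  then obtain n where "\<Union>(range f) = f n"
    by blast
  thus False
    using f(2)[of n] by blast
qed

context module begin

text \<open>This is the colon ideal \<open>(N : a)\<close>, the kernel of the map from
  \<open>R\<close> to \<open>M/N\<close> that sends \<open>r\<close> to the class of
  \<open>r a\<close>.\<close>

lemma ideal_colon:
  assumes N: "submodule N R M" and a: "a \<in> carrier M"
  shows "ideal {r \<in> carrier R. r \<odot>\<^bsub>M\<^esub> a \<in> N} R"
proof (rule idealI)
  show "ring R"
    by (rule R.ring_axioms)
  show "subgroup {r \<in> carrier R. r \<odot>\<^bsub>M\<^esub> a \<in> N} (add_monoid R)"
    by (rule R.add.subgroupI)
      (use a submodule_zero[OF N] submoduleE[OF N] smult_l_minus[of _ a]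
        in \<open>auto simp: smult_l_distr a_inv_def[symmetric] intro!: exI[of _ "\<zero>"]\<close>)
  fix r x assume "r \<in> {r \<in> carrier R. r \<odot>\<^bsub>M\<^esub> a \<in> N}" and x: "x \<in> carrier R"
  thus "x \<otimes> r \<in> {r \<in> carrier R. r \<odot>\<^bsub>M\<^esub> a \<in> N}"
    using a submoduleE(4)[OF N] by (simp add: smult_assoc1)
  thus "r \<otimes> x \<in> {r \<in> carrier R. r \<odot>\<^bsub>M\<^esub> a \<in> N}"
    using \<open>r \<in> _\<close> x by (simp add: R.m_comm)
qed

lemma submodule_cyclic:
  assumes a: "a \<in> carrier M"
  shows "submodule ((\<lambda>r. r \<odot>\<^bsub>M\<^esub> a) ` carrier R) R M"
proof (rule submoduleI)
  show "\<zero>\<^bsub>M\<^esub> \<in> (\<lambda>r. r \<odot>\<^bsub>M\<^esub> a) ` carrier R"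
    using a by (intro image_eqI[of _ _ "\<zero>"]) auto
qed (use a in \<open>auto simp: smult_l_distr[symmetric] smult_l_minus[symmetric] smult_assoc1[symmetric]\<close>)

lemma subset_set_add:
  assumes "submodule P R M" "submodule Q R M"
  shows "P \<subseteq> P <+>\<^bsub>M\<^esub> Q" "Q \<subseteq> P <+>\<^bsub>M\<^esub> Q"
  using submodule_zero submoduleE(1) assms by (force simp: set_add_def')+

text \<open>A submodule \<open>N\<close> of \<open>S + R a\<close> is determined, among those comparable with it, by \<open>N \<inter> S\<close> and
  the ideal of all \<open>r\<close> with \<open>r a \<in> N + S\<close>.\<close>

lemma wf_submodule_above_add_cyclic:
  assumes R: "noetherian_ring R" and S: "submodule S R M" and a: "a \<in> carrier M"
    and wf: "wf (submodule_above R (M\<lparr>carrier := S\<rparr>))"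
  shows "wf (submodule_above R (M\<lparr>carrier := S <+>\<^bsub>M\<^esub> (\<lambda>r. r \<odot>\<^bsub>M\<^esub> a) ` carrier R\<rparr>))"
proof -
  let ?T = "S <+>\<^bsub>M\<^esub> (\<lambda>r. r \<odot>\<^bsub>M\<^esub> a) ` carrier R"
  let ?I = "\<lambda>N. {r \<in> carrier R. r \<odot>\<^bsub>M\<^esub> a \<in> N <+>\<^bsub>M\<^esub> S}"
  let ?r = "{(I', I). ideal I' R \<and> ideal I R \<and> I \<subset> I'}"
  let ?s = "submodule_above R (M\<lparr>carrier := S\<rparr>)"
  have M: "module R M"
    by (rule module_axioms)
  have T: "submodule ?T R M"
    by (intro submodule_add S submodule_cyclic a)
  have eq: "N = N'" if N: "submodule N R M" "submodule N' R M" "N \<subseteq> N'" "N' \<subseteq> ?T"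
    and I: "?I N = ?I N'" and S': "N \<inter> S = N' \<inter> S" for N N'
  proof -
    note c = submoduleE(1)[OF S] submoduleE(1)[OF N(1)] submoduleE(1)[OF N(2)]
    have "N' \<subseteq> N"
    proof
      \<comment> \<open>Write \<open>x = s + r a\<close>. Then \<open>r a = x - s\<close> lies in
        \<open>N' + S\<close>, so \<open>r\<close> belongs to the common colon ideal and
        \<open>r a\<close> can be rewritten as \<open>n + t\<close> with \<open>n\<close> in
        \<open>N\<close> instead of \<open>N'\<close>.\<close>
      fix x assume x: "x \<in> N'"
      then obtain s r where sr: "s \<in> S" "r \<in> carrier R" "x = s \<oplus>\<^bsub>M\<^esub> r \<odot>\<^bsub>M\<^esub> a"
        using N(4) by (auto simp: set_add_def')
      have "s \<in> carrier M" "x \<in> carrier M"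
        using sr x c by auto
      hence "r \<odot>\<^bsub>M\<^esub> a = x \<oplus>\<^bsub>M\<^esub> \<ominus>\<^bsub>M\<^esub> s"
        using sr(2,3) a M.r_neg1 M.a_comm[of x "\<ominus>\<^bsub>M\<^esub> s"] by simp
      moreover have "\<ominus>\<^bsub>M\<^esub> s \<in> S"
        using sr(1) by (rule submoduleE(3)[OF S])
      ultimately have "r \<in> ?I N'"
        using x sr(2) unfolding set_add_def' by blast
      then obtain n t where nt: "n \<in> N" "t \<in> S" "r \<odot>\<^bsub>M\<^esub> a = n \<oplus>\<^bsub>M\<^esub> t"
        unfolding I[symmetric] by (auto simp: set_add_def')
      \<comment> \<open>The remainder \<open>s + t = x - n\<close> lies in both \<open>S\<close> and
        \<open>N'\<close>, hence in \<open>N\<close> because the two intersections with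
        \<open>S\<close> agree.\<close>
      hence xn: "x = n \<oplus>\<^bsub>M\<^esub> (s \<oplus>\<^bsub>M\<^esub> t)"
        using sr c by (simp add: subset_iff M.a_lcomm)
      moreover have "s \<oplus>\<^bsub>M\<^esub> t \<in> S"
        using sr nt submoduleE(5)[OF S] by blast
      moreover from this have "s \<oplus>\<^bsub>M\<^esub> t = \<ominus>\<^bsub>M\<^esub> n \<oplus>\<^bsub>M\<^esub> x"
        using xn nt(1) c M.r_neg1 by (simp add: subset_iff)
      moreover from this have "s \<oplus>\<^bsub>M\<^esub> t \<in> N'"
        using x nt N submoduleE(3,5)[OF N(2)] by auto
      ultimately show "x \<in> N"
        using S' nt(1) submoduleE(5)[OF N(1)] by blast
    qed
    thus ?thesis
      using N by blast
  qed
  show ?thesis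
  proof (rule wf_subset)
    \<comment> \<open>A strict enlargement of \<open>N\<close> either enlarges the colon ideal or
      keeps it and, by \<open>eq\<close>, enlarges \<open>N \<inter> S\<close>. The first can be
      controlled by \<open>R\<close>, the second by the hypothesis on \<open>S\<close>.\<close>
    show "wf (inv_image (?r <*lex*> ?s) (\<lambda>N. (?I N, N \<inter> S)))"
      by (intro wf_inv_image wf_lex_prod wf noetherian_ring.wf_ideal_above R)
    show "submodule_above R (M\<lparr>carrier := ?T\<rparr>) \<subseteq> inv_image (?r <*lex*> ?s) (\<lambda>N. (?I N, N \<inter> S))"
    proof (rule subrelI)
      fix N' N assume "(N', N) \<in> submodule_above R (M\<lparr>carrier := ?T\<rparr>)"
      hence N: "submodule N' R M" "submodule N R M" "N' \<subseteq> ?T" "N \<subset> N'"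
        by (auto simp: submodule_above_def submodule_restrict_iff[OF M T])
      have "ideal (?I N') R" "ideal (?I N) R"
        using N by (auto intro!: ideal_colon submodule_add S a)
      moreover have "?I N \<subseteq> ?I N'"
        using N set_add_mono'[of N N' S S M] by blast
      moreover have "N \<inter> S \<subset> N' \<inter> S" if "?I N = ?I N'"
        using eq[of N N'] that N by blast
      moreover have "submodule (N \<inter> S) R (M\<lparr>carrier := S\<rparr>)" "submodule (N' \<inter> S) R (M\<lparr>carrier := S\<rparr>)"
        using N S by (auto simp: submodule_restrict_iff[OF M S] intro: submodule_Int)
      ultimately show "(N', N) \<in> inv_image (?r <*lex*> ?s) (\<lambda>N. (?I N, N \<inter> S))"
        unfolding in_inv_image in_lex_prod submodule_above_def by blast
    qed
  qed
qed

text \<open>Induction on a finite generating set: start from the zero module, which has no strict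
  inclusions, and add one cyclic submodule at a time.\<close>

lemma wf_submodule_above:
  assumes R: "noetherian_ring R" and fg: "finitely_generated_module R M"
  shows "wf (submodule_above R M)"
proof -
  have M: "module R M"
    by (rule module_axioms)
  obtain A where A: "finite A" "A \<subseteq> carrier M" "\<Inter>{H. submodule H R M \<and> A \<subseteq> H} = carrier M"
    using fg by (auto simp: finitely_generated_module_def)
  have "\<exists>S. submodule S R M \<and> A \<subseteq> S \<and> wf (submodule_above R (M\<lparr>carrier := S\<rparr>))"
    using A(1,2)
  proof induction
    case empty
    have "submodule_above R (M\<lparr>carrier := {\<zero>\<^bsub>M\<^esub>}\<rparr>) = {}"
      using submodule_zero by (auto simp: submodule_above_def submodule_restrict_iff[OF M submodule_zero_set])
    thus ?case
      using submodule_zero_set by (intro exI[of _ "{\<zero>\<^bsub>M\<^esub>}"]) simp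
  next
    case (insert a A)
    then obtain S where S: "submodule S R M" "A \<subseteq> S" "wf (submodule_above R (M\<lparr>carrier := S\<rparr>))"
      by auto
    let ?C = "(\<lambda>r. r \<odot>\<^bsub>M\<^esub> a) ` carrier R"
    have a: "a \<in> carrier M" and C: "submodule ?C R M"
      using insert.prems submodule_cyclic by auto
    have "a \<in> ?C"
      using a by (intro image_eqI[of _ _ "\<one>"]) auto
    hence "insert a A \<subseteq> S <+>\<^bsub>M\<^esub> ?C"
      using subset_set_add[OF S(1) C] S(2) by blast
    thus ?case
      using submodule_add[OF S(1) C] wf_submodule_above_add_cyclic[OF R S(1) a S(3)] by blast
  qed
  then obtain S where S: "submodule S R M" "A \<subseteq> S" "wf (submodule_above R (M\<lparr>carrier := S\<rparr>))"
    by blast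
  \<comment> \<open>\<open>S\<close> is one of the submodules in the intersection that defines
    generation by \<open>A\<close>.\<close>
  hence "S = carrier M"
    using A(3) submoduleE(1)[OF S(1)] by blast
  thus ?thesis
    using S(3) by simp
qed

end

section \<open>Lengths of independent submodules\<close>

lemma open_submodule_imp_essential:
  assumes M: "module R M" and wf: "wf (submodule_above R M)" and U: "open_submodule R M U"
  shows "essential_submodule R M U"
  unfolding essential_submodule_def
proof (intro conjI allI impI notI; (elim conjE)?)
  interpret module R M by (rule M)
  show U': "submodule U R M"
    using U by (simp add: open_submodule_def)
  fix N assume N: "submodule N R M" "N \<noteq> {\<zero>\<^bsub>M\<^esub>}" and UN: "U \<inter> N = {\<zero>\<^bsub>M\<^esub>}"
  let ?Z = "{\<zero>\<^bsub>M\<^esub>}"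
  let ?len = "\<lambda>V. ordinal_length R (M\<lparr>carrier := V\<rparr>)"
  have z: "\<zero>\<^bsub>M\<^esub> \<in> U" "\<zero>\<^bsub>M\<^esub> \<in> N"
    using submodule_zero U' N by auto
  have N0: "submodule ?Z R (M\<lparr>carrier := N\<rparr>)" "submodule N R (M\<lparr>carrier := N\<rparr>)"
    using submodule_zero_set N z by (auto simp: submodule_restrict_iff[OF M N(1)])
  have "?Z \<subset> N"
    using N(2) z(2) by blast
  \<comment> \<open>The non-zero submodule \<open>N\<close> lies strictly above zero within itself,
    so its own rank is a witness that \<open>len N\<close> is not the least ordinal.\<close>
  hence "height_rank R (M\<lparr>carrier := N\<rparr>) N < ?len N"
    using less_height_rank_iff[OF wf_submodule_above_restrict[OF wf M N(1)] N0(1)] N0(2)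
    by (auto simp: ordinal_length_def)
  \<comment> \<open>The zero module has no submodule strictly above zero, so no rank lies below its
    length: this length is the ordinal 0, expressed as a lower bound.\<close>
  moreover have "?len ?Z \<le> \<alpha>" for \<alpha>
  proof (rule ccontr)
    assume "\<not> ?len ?Z \<le> \<alpha>"
    thus False
      using less_height_rank_iff[OF wf_submodule_above_restrict[OF wf M submodule_zero_set], of ?Z \<alpha>]
      by (auto simp: ordinal_length_def not_le submodule_restrict_iff[OF M submodule_zero_set] submodule_zero_set)
  qed
  ultimately have "?len ?Z < ?len N"
    by (rule order.strict_trans1[rotated])
  \<comment> \<open>Openness of \<open>U\<close> makes the first components equal; the second ones
    differ strictly.\<close>
  hence "((ordinal_length R M, ?len ?Z), (?len U, ?len N)) \<in> prod_less"
    using U by (simp add: prod_less_def open_submodule_def less_imp_le less_imp_neq)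
  hence "wf_rank prod_less (ordinal_length R M, ?len ?Z) < wf_rank prod_less (?len U, ?len N)"
    by (rule wf_rank_prod_less_mono)
  moreover have "?Z <+>\<^bsub>M\<^esub> ?Z = ?Z"
    by (auto simp: set_add_def')
  \<comment> \<open>Take \<open>P = Q = 0\<close> in \<open>height_rank_sum_le\<close>. The
    intersection term is the length of \<open>U \<inter> N = 0\<close>, and the sum term is the rank
    of \<open>0 + 0 = 0\<close> in \<open>M\<close>, that is \<open>len M\<close>.\<close>
  hence "wf_rank prod_less (?len U, ?len N) \<le> wf_rank prod_less (ordinal_length R M, ?len ?Z)"
    using height_rank_sum_le[OF M wf U' N(1) submodule_zero_set _ submodule_zero_set] z
    by (simp add: UN ordinal_length_def)
  ultimately show False
    by simp
qed

section \<open>Neighbourhoods of zero in the canonical topology\<close>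

text \<open>An open set is a union of cosets of open submodules, and a coset \<open>x + U\<close>
  that contains 0 contains \<open>U\<close>.\<close>

lemma open_submodule_subset_nhd_zero:
  assumes M: "module R M" and wf: "wf (submodule_above R M)"
    and T: "openin (canonical_topology R M) T" "\<zero>\<^bsub>M\<^esub> \<in> T"
  obtains U where "open_submodule R M U" "U \<subseteq> T"
proof -
  interpret module R M by (rule M)
  obtain x U where U: "x \<in> carrier M" "open_submodule R M U" "x <+\<^bsub>M\<^esub> U \<subseteq> T" "\<zero>\<^bsub>M\<^esub> \<in> x <+\<^bsub>M\<^esub> U"
    using T unfolding openin_canonical_topology[OF M wf] by blast
  have U': "submodule U R M"
    using U(2) by (simp add: open_submodule_def)
  obtain u where u: "u \<in> U" "\<zero>\<^bsub>M\<^esub> = x \<oplus>\<^bsub>M\<^esub> u"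
    using U(4) by (auto simp: a_l_coset_def')
  have "w \<in> x <+\<^bsub>M\<^esub> U" if "w \<in> U" for w
  proof -
    \<comment> \<open>Here \<open>u\<close> is the negative of \<open>x\<close>, so
      \<open>w = (x + u) + w\<close>.\<close>
    have "w = x \<oplus>\<^bsub>M\<^esub> (u \<oplus>\<^bsub>M\<^esub> w)"
      using u that U(1) submoduleE(1)[OF U'] by (simp add: subset_iff M.a_assoc[symmetric] u(2)[symmetric])
    thus ?thesis
      using submoduleE(5)[OF U' u(1) that] unfolding a_l_coset_def' by blast
  qed
  thus thesis
    using U that by blast
qed

text \<open>A limit point must belong to the topological space. \<open>M\<close> has its own length,
  so its carrier is an open submodule and the coset of 0 for it.\<close>

lemma topspace_canonical_topology:
  assumes M: "module R M" and wf: "wf (submodule_above R M)"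
  shows "topspace (canonical_topology R M) = carrier M"
proof
  interpret module R M by (rule M)
  show "topspace (canonical_topology R M) \<subseteq> carrier M"
    using openin_topspace[of "canonical_topology R M"] submoduleE(1)
    unfolding openin_canonical_topology[OF M wf]
    by (fastforce simp: a_l_coset_def' open_submodule_def)
  have "carrier M = \<zero>\<^bsub>M\<^esub> <+\<^bsub>M\<^esub> carrier M"
    by (auto simp: a_l_coset_def')
  moreover have "open_submodule R M (carrier M)"
    using carrier_is_submodule by (simp add: open_submodule_def)
  ultimately have "openin (canonical_topology R M) (carrier M)"
    unfolding openin_canonical_topology[OF M wf] by (intro exI[of _ "{carrier M}"]) auto
  thus "carrier M \<subseteq> topspace (canonical_topology R M)"
    by (rule openin_subset)
qed

theorem corollary6p6:
  fixes R :: "('a, 'm) ring_scheme" and M :: "('a, 'b, 'n) module_scheme"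
  assumes "cring R" and "noetherian_ring R" and "krull_dim R < \<infinity>"
    and "module R M" and "finitely_generated_module R M"
  shows "(\<forall>U. open_submodule R M U \<longrightarrow> essential_submodule R M U)
    \<and> (\<forall>N. submodule N R M \<and> N \<noteq> {\<zero>\<^bsub>M\<^esub>} \<longrightarrow> \<zero>\<^bsub>M\<^esub> \<in> canonical_topology R M derived_set_of N)"
proof (intro conjI allI impI, goal_cases)
  note M = \<open>module R M\<close>
  interpret module R M by (rule M)
  have wf: "wf (submodule_above R M)"
    using wf_submodule_above assms by blast
  {
    case 1
    thus ?case
      by (rule open_submodule_imp_essential[OF M wf])
  next
    case (2 N)
    \<comment> \<open>The neighbourhood \<open>T\<close> contains an open submodule
      \<open>U\<close>. Essentiality makes \<open>U \<inter> N\<close> differ from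
      \<open>{0}\<close>; since it contains 0, it has a non-zero element as well.\<close>
    have "\<exists>y. y \<noteq> \<zero>\<^bsub>M\<^esub> \<and> y \<in> N \<and> y \<in> T"
      if T: "openin (canonical_topology R M) T" "\<zero>\<^bsub>M\<^esub> \<in> T" for T
    proof -
      obtain U where U: "open_submodule R M U" "U \<subseteq> T"
        using open_submodule_subset_nhd_zero[OF M wf T] .
      have "U \<inter> N \<noteq> {\<zero>\<^bsub>M\<^esub>}"
        using open_submodule_imp_essential[OF M wf U(1)] 2 by (simp add: essential_submodule_def)
      moreover have "\<zero>\<^bsub>M\<^esub> \<in> U \<inter> N"
        using U(1) 2 submodule_zero by (simp add: open_submodule_def)
      ultimately show ?thesis
        using U(2) by blast
    qed
    thus ?case
      unfolding derived_set_of_def topspace_canonical_topology[OF M wf] by blast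
  }
qed

end
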